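(* Let $\mathcal A = (Q,\Sigma,\delta,q_0,F)$ be a permutation DFA and let $\Gamma\subseteq\Sigma$. Let $m$ be the number of states of $\mathcal A$ that are incident with a non-loop transition labeled by a letter of $\Sigma\setminus\Gamma$, i.e. $m=|S|$, where $S$ is the set of all states $s\in Q$ for which there exist $p,q\in Q$ with $p\neq q$, $s\in\{p,q\}$ and $\delta(p,x)=q$ for some $x\in\Sigma\setminus\Gamma$. If $m>0$, then the projected language $\pi_\Gamma(L(\mathcal A))$ is recognizable by a DFA with at most $2^{|Q|-\lceil m/2\rceil}-1$ states; and if $m=0$, then $\pi_\Gamma(L(\mathcal A))$ is recognizable by a DFA with at most $|Q|$ states.
   Context: A (partial) deterministic finite automaton (DFA) is a quintuple $\mathcal A=(Q,\Sigma,\delta,q_0,F)$ with finite state set $Q$, finite alphabet $\Sigma$, partial transition function $\delta:Q\times\Sigma\to Q$ (extended to words in the usual way), start state $q_0\in Q$ and final states $F\subseteq Q$. It recognizes $L(\mathcal A)=\{u\in\Sigma^*\mid \delta(q_0,u)\text{ is defined and in }F\}$. A permutation DFA is a DFA in which, for every letter $x\in\Sigma$, the map $\delta_x:Q\to Q$, $q\mapsto\delta(q,x)$, is a (totally defined) bijection of $Q$. For $\Gamma\subseteq\Sigma$, the projection $\pi_\Gamma:\Sigma^*\to\Gamma^*$ is the monoid homomorphism with $\pi_\Gamma(x)=x$ for $x\in\Gamma$ and $\pi_\Gamma(x)=\varepsilon$ for $x\in\Sigma\setminus\Gamma$. A language over $\Gamma$ is recognizable by a DFA with at most $k$ states if it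 equals $L(\mathcal B)$ for some (partial) DFA $\mathcal B$ over the alphabet $\Gamma$ with at most $k$ states. *)

theory Defs
  imports Complex_Main
begin

record ('q, 'a) dfa =
  states :: "'q set"
  alphabet :: "'a set"
  trans :: "'q \<Rightarrow> 'a \<Rightarrow> 'q option"
  start :: 'q
  finals :: "'q set"

text \<open>
  Transitions are partial: \<open>None\<close> means undefined. The values of \<open>trans\<close> outside
  \<open>states \<times> alphabet\<close> carry no meaning and are left unconstrained; no notion below
  depends on them.
\<close>

definition is_dfa :: "('q, 'a) dfa \<Rightarrow> bool" where
  "is_dfa A \<longleftrightarrow>
     finite (states A) \<and> finite (alphabet A) \<and>
     (\<forall>q\<in>states A. \<forall>x\<in>alphabet A. \<forall>p. trans A q x = Some p \<longrightarrow> p \<in> states A) \<and>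
     start A \<in> states A \<and> finals A \<subseteq> states A"

primrec trans_word :: "('q, 'a) dfa \<Rightarrow> 'q \<Rightarrow> 'a list \<Rightarrow> 'q option" where
  "trans_word A q [] = Some q"
| "trans_word A q (x # u) = Option.bind (trans A q x) (\<lambda>p. trans_word A p u)"

definition language :: "('q, 'a) dfa \<Rightarrow> 'a list set" where
  "language A = {u \<in> lists (alphabet A). \<exists>q \<in> finals A. trans_word A (start A) u = Some q}"

definition permutation_dfa :: "('q, 'a) dfa \<Rightarrow> bool" where
  "permutation_dfa A \<longleftrightarrow>
     is_dfa A \<and>
     (\<forall>x\<in>alphabet A.
        (\<forall>q\<in>states A. trans A q x \<noteq> None) \<and>
        bij_betw (\<lambda>q. the (trans A q x)) (states A) (states A))"

definition proj :: "'a set \<Rightarrow> 'a list \<Rightarrow> 'a list" where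
  "proj \<Gamma> u = filter (\<lambda>x. x \<in> \<Gamma>) u"

definition nonloop_states :: "('q, 'a) dfa \<Rightarrow> 'a set \<Rightarrow> 'q set" where
  "nonloop_states A \<Delta> =
     {s \<in> states A. \<exists>p\<in>states A. \<exists>q\<in>states A. \<exists>x\<in>\<Delta>.
        p \<noteq> q \<and> s \<in> {p, q} \<and> trans A p x = Some q}"

text \<open>
  HOL cannot quantify existentially over the type of states, so the states of the
  recognizing automaton are natural numbers. This loses no generality, see
  \<open>recognizableI\<close>.
\<close>

definition recognizable :: "'a set \<Rightarrow> nat \<Rightarrow> 'a list set \<Rightarrow> bool" where
  "recognizable \<Gamma> k L \<longleftrightarrow>
     (\<exists>B :: (nat, 'a) dfa.
        is_dfa B \<and> alphabet B = \<Gamma> \<and> card (states B) \<le> k \<and> language B = L)"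

lemma recognizableI:
  fixes B :: "('q, 'a) dfa"
  assumes B: "is_dfa B" and k: "card (states B) \<le> k"
  shows "recognizable (alphabet B) k (language B)"
proof -
  have fin: "finite (states B)" using B by (simp add: is_dfa_def)
  then obtain f :: "'q \<Rightarrow> nat" where f: "inj_on f (states B)"
    using finite_imp_inj_to_nat_seg by blast
  define g where "g = inv_into (states B) f"
  have gf: "g (f q) = q" if "q \<in> states B" for q
    using f that by (simp add: g_def)
  define C :: "(nat, 'a) dfa" where
    "C = \<lparr>states = f ` states B, alphabet = alphabet B,
          trans = (\<lambda>n x. map_option f (trans B (g n) x)),
          start = f (start B), finals = f ` finals B\<rparr>"
  have C: "is_dfa C"
    unfolding is_dfa_def
  proof (intro conjI ballI allI impI)
    fix n x m
    assume "n \<in> states C" "x \<in> alphabet C" and t: "trans C n x = Some m"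
    then obtain q where q: "q \<in> states B" "n = f q" and x: "x \<in> alphabet B"
      by (auto simp: C_def)
    from t q gf obtain p where "trans B q x = Some p" "m = f p"
      by (auto simp: C_def)
    with B q x show "m \<in> states C" by (simp add: is_dfa_def C_def)
  qed (use B in \<open>auto simp: is_dfa_def C_def\<close>)
  have tw: "trans_word C (f q) u = map_option f (trans_word B q u)
            \<and> (\<forall>p. trans_word B q u = Some p \<longrightarrow> p \<in> states B)"
    if "q \<in> states B" "u \<in> lists (alphabet B)" for q u
    using that
  proof (induction u arbitrary: q)
    case Nil
    then show ?case by simp
  next
    case (Cons x u)
    have t: "trans C (f q) x = map_option f (trans B q x)"
      using gf[OF Cons.prems(1)] by (simp add: C_def)
    show ?case
    proof (cases "trans B q x")
      case None
      then show ?thesis using t by simp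
    next
      case (Some p)
      moreover have "p \<in> states B"
        using B Cons.prems Some by (auto simp: is_dfa_def)
      ultimately show ?thesis using t Cons by simp
    qed
  qed
  have s: "start B \<in> states B" and F: "finals B \<subseteq> states B"
    using B by (simp_all add: is_dfa_def)
  have "(\<exists>n\<in>finals C. trans_word C (start C) u = Some n) \<longleftrightarrow>
        (\<exists>q\<in>finals B. trans_word B (start B) u = Some q)"
    if u: "u \<in> lists (alphabet B)" for u
  proof -
    have "start C = f (start B)" "finals C = f ` finals B" by (simp_all add: C_def)
    moreover have "p \<in> finals B"
      if "trans_word B (start B) u = Some p" "f p = f q" "q \<in> finals B" for p q
    proof -
      have "p \<in> states B" using tw[OF s u] that(1) by blast
      with that F f have "p = q" by (meson inj_onD subsetD)
      with that show ?thesis by simp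
    qed
    ultimately show ?thesis using tw[OF s u] by auto
  qed
  moreover have "alphabet C = alphabet B" by (simp add: C_def)
  ultimately have "language C = language B"
    by (auto simp: language_def)
  moreover have "card (states C) \<le> k"
    using k card_image_le[OF fin, of f] by (simp add: C_def)
  ultimately show ?thesis
    using C \<open>alphabet C = alphabet B\<close> unfolding recognizable_def by blast
qed

end

theory Submission
  imports Defs
begin

text \<open>
  Determinize by the subset construction. An erased letter maps the finite set of states
  reachable from \<open>q\<close> by erased letters injectively, hence onto, itself; so this reachability is
  symmetric, and the subsets that occur are nonempty unions of its equivalence classes. A state
  incident with a non-loop erased transition lies in a class with at least two elements; summing
  \<open>2 + card (C \<inter> N) \<le> 2 * card C\<close> over the classes \<open>C\<close>, with \<open>N\<close> the set of these states,
  bounds the number of classes by \<open>card Q - \<lceil>m / 2\<rceil>\<close>. If all erased transitions are loops,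
  it suffices to restrict the alphabet.
\<close>

section \<open>Runs on words and cutting of filtered words\<close>

lemma trans_word_append:
  "trans_word A q (u @ v) = Option.bind (trans_word A q u) (\<lambda>p. trans_word A p v)"
  by (induction u arbitrary: q) (auto split: Option.bind_split)

lemma is_dfa_trans_in_states:
  "is_dfa A \<Longrightarrow> q \<in> states A \<Longrightarrow> x \<in> alphabet A \<Longrightarrow> trans A q x = Some p \<Longrightarrow> p \<in> states A"
  by (simp add: is_dfa_def)

text \<open>A run on a word with projection \<open>v @ w\<close> has to be cut into pieces that
  project to \<open>v\<close> and to \<open>w\<close>. The dropped letters at the cut could go to
  either side; the induction puts them into \<open>u2\<close>.\<close>

lemma filter_eq_appendE:
  assumes "filter P u = v @ w"
  obtains u1 u2 where "u = u1 @ u2" "filter P u1 = v" "filter P u2 = w"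
proof -
  have "\<exists>u1 u2. u = u1 @ u2 \<and> filter P u1 = v \<and> filter P u2 = w"
    using assms
  proof (induction v arbitrary: u)
    case Nil
    then show ?case by (intro exI[of _ "[]"] exI[of _ u]) simp
  next
    case (Cons x v)
    then obtain a b where u: "u = a @ x # b" "\<forall>y\<in>set a. \<not> P y" "P x" "v @ w = filter P b"
      by (auto simp: filter_eq_Cons_iff)
    then obtain u1 u2 where "b = u1 @ u2" "filter P u1 = v" "filter P u2 = w"
      using Cons.IH[of b] by auto
    then show ?case
      using u by (intro exI[of _ "a @ x # u1"] exI[of _ u2]) (simp add: filter_empty_conv)
  qed
  then show thesis using that by blast
qed

lemma trans_word_in_states:
  assumes "is_dfa A" "q \<in> states A" "u \<in> lists (alphabet A)" "trans_word A q u = Some p"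
  shows "p \<in> states A"
  using assms(2-)
proof (induction u arbitrary: q)
  case (Cons x u)
  then obtain r where "trans A q x = Some r" "trans_word A r u = Some p"
    by (auto simp: bind_eq_Some_conv)
  moreover from this have "r \<in> states A"
    using is_dfa_trans_in_states[OF assms(1)] Cons.prems by auto
  ultimately show ?case using Cons by simp
qed simp

section \<open>Reachability along projected words\<close>

text \<open>Erased letters act as silent moves: \<open>proj_reach A \<Gamma> S []\<close> is the
  closure of \<open>S\<close> under them, and for general \<open>v\<close> they may occur before,
  between and after the letters of \<open>v\<close>.\<close>

definition proj_reach :: "('q, 'a) dfa \<Rightarrow> 'a set \<Rightarrow> 'q set \<Rightarrow> 'a list \<Rightarrow> 'q set" where
  "proj_reach A \<Gamma> S v =
     {q. \<exists>p\<in>S. \<exists>u\<in>lists (alphabet A). proj \<Gamma> u = v \<and> trans_word A p u = Some q}"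

lemma proj_reachI:
  assumes "p \<in> S" "u \<in> lists (alphabet A)" "trans_word A p u = Some q"
  shows "q \<in> proj_reach A \<Gamma> S (proj \<Gamma> u)"
  using assms by (auto simp: proj_reach_def)

text \<open>Runs are cut at the boundary of \<open>v\<close> and \<open>w\<close>, and glued there.
  With an empty factor this shows that every \<open>proj_reach A \<Gamma> S v\<close> is closed
  under erased letters and that closing \<open>S\<close> beforehand changes nothing.\<close>

lemma proj_reach_append:
  "proj_reach A \<Gamma> S (v @ w) = proj_reach A \<Gamma> (proj_reach A \<Gamma> S v) w"
proof (intro equalityI subsetI)
  fix q assume "q \<in> proj_reach A \<Gamma> S (v @ w)"
  then obtain p u where p: "p \<in> S" and u: "u \<in> lists (alphabet A)" "proj \<Gamma> u = v @ w"
    "trans_word A p u = Some q"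
    by (auto simp: proj_reach_def)
  then obtain u1 u2 where s: "u = u1 @ u2" "proj \<Gamma> u1 = v" "proj \<Gamma> u2 = w"
    unfolding proj_def by (elim filter_eq_appendE) auto
  with u obtain r where "trans_word A p u1 = Some r" "trans_word A r u2 = Some q"
    by (auto simp: trans_word_append bind_eq_Some_conv)
  then show "q \<in> proj_reach A \<Gamma> (proj_reach A \<Gamma> S v) w"
    using p u(1) s by (auto intro!: proj_reachI)
next
  fix q assume "q \<in> proj_reach A \<Gamma> (proj_reach A \<Gamma> S v) w"
  then obtain p r u1 u2 where "p \<in> S" "u1 \<in> lists (alphabet A)" "u2 \<in> lists (alphabet A)"
    "proj \<Gamma> u1 = v" "proj \<Gamma> u2 = w" "trans_word A p u1 = Some r" "trans_word A r u2 = Some q"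
    by (auto simp: proj_reach_def)
  then show "q \<in> proj_reach A \<Gamma> S (v @ w)"
    using proj_reachI[of p S "u1 @ u2" A q \<Gamma>] by (simp add: trans_word_append proj_def)
qed

lemma proj_reach_subset_states:
  assumes "is_dfa A" "S \<subseteq> states A"
  shows "proj_reach A \<Gamma> S v \<subseteq> states A"
  using assms trans_word_in_states by (fastforce simp: proj_reach_def)

lemma subset_proj_reach_Nil: "S \<subseteq> proj_reach A \<Gamma> S []"
  using proj_reachI[of _ S "[]" A] by (auto simp: proj_def)

lemma proj_reach_UN: "proj_reach A \<Gamma> S v = (\<Union>p\<in>S. proj_reach A \<Gamma> {p} v)"
  by (auto simp: proj_reach_def)

section \<open>The subset automaton on closed sets\<close>

text \<open>Admitting only closed sets, instead of all subsets, is what lets the number of states be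
  bounded through the number of classes. Leaving out the empty set saves the one state subtracted in
  the bound.\<close>

definition proj_dfa :: "('q, 'a) dfa \<Rightarrow> 'a set \<Rightarrow> ('q set, 'a) dfa" where
  "proj_dfa A \<Gamma> =
     (let Q = {S. S \<subseteq> states A \<and> S \<noteq> {} \<and> proj_reach A \<Gamma> S [] = S}
      in \<lparr>states = Q, alphabet = \<Gamma>,
          trans = (\<lambda>S x. Some (proj_reach A \<Gamma> S [x])),
          start = proj_reach A \<Gamma> {start A} [],
          finals = {S \<in> Q. S \<inter> finals A \<noteq> {}}\<rparr>)"

lemma proj_dfa_simps [simp]:
  "states (proj_dfa A \<Gamma>) = {S. S \<subseteq> states A \<and> S \<noteq> {} \<and> proj_reach A \<Gamma> S [] = S}"
  "alphabet (proj_dfa A \<Gamma>) = \<Gamma>"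
  "trans (proj_dfa A \<Gamma>) S x = Some (proj_reach A \<Gamma> S [x])"
  "start (proj_dfa A \<Gamma>) = proj_reach A \<Gamma> {start A} []"
  "finals (proj_dfa A \<Gamma>) = {S \<in> states (proj_dfa A \<Gamma>). S \<inter> finals A \<noteq> {}}"
  by (simp_all add: proj_dfa_def Let_def)

lemma permutation_dfa_trans_total:
  assumes "permutation_dfa A" "x \<in> alphabet A" "q \<in> states A"
  obtains p where "p \<in> states A" "trans A q x = Some p"
  using assms by (fastforce simp: permutation_dfa_def is_dfa_def)

text \<open>Letters of a permutation DFA are defined everywhere, so the empty set, which is not a
  state of \<open>proj_dfa\<close>, never arises as a successor.\<close>

lemma proj_reach_letter_nonempty:
  assumes "permutation_dfa A" "S \<subseteq> states A" "S \<noteq> {}" "x \<in> \<Gamma>" "\<Gamma> \<subseteq> alphabet A"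
  shows "proj_reach A \<Gamma> S [x] \<noteq> {}"
proof -
  obtain p where p: "p \<in> S" using assms by blast
  with assms obtain q where "trans A p x = Some q"
    by (meson permutation_dfa_trans_total subsetD)
  then have "q \<in> proj_reach A \<Gamma> S (proj \<Gamma> [x])"
    using p assms by (intro proj_reachI) auto
  then show ?thesis using assms(4) by (auto simp: proj_def)
qed

lemma is_dfa_proj_dfa:
  assumes "permutation_dfa A" "\<Gamma> \<subseteq> alphabet A"
  shows "is_dfa (proj_dfa A \<Gamma>)"
proof -
  have A: "is_dfa A" using assms by (simp add: permutation_dfa_def)
  then have *: "finite (states A)" "finite \<Gamma>" "start A \<in> states A"
    using assms(2) by (auto simp: is_dfa_def intro: finite_subset)
  have "proj_reach A \<Gamma> (proj_reach A \<Gamma> S v) [] = proj_reach A \<Gamma> S v" for S v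
    by (simp flip: proj_reach_append)
  moreover have "proj_reach A \<Gamma> {start A} [] \<noteq> {}"
    using subset_proj_reach_Nil[of "{start A}"] by auto
  ultimately show ?thesis
    using * proj_reach_subset_states[OF A] proj_reach_letter_nonempty[OF assms(1)] assms(2)
    by (auto simp: is_dfa_def)
qed

text \<open>On the empty word the automaton stays in \<open>S\<close> while
  \<open>proj_reach\<close> passes to the closure of \<open>S\<close>; for closed \<open>S\<close>
  the two agree. The set reached after a letter is closed again, so the induction goes on.\<close>

lemma trans_word_proj_dfa:
  "proj_reach A \<Gamma> S [] = S \<Longrightarrow> trans_word (proj_dfa A \<Gamma>) S v = Some (proj_reach A \<Gamma> S v)"
proof (induction v arbitrary: S)
  case (Cons x v)
  then show ?case by (simp flip: proj_reach_append)
qed simp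

lemma language_proj_dfa:
  assumes "permutation_dfa A" "\<Gamma> \<subseteq> alphabet A"
  shows "language (proj_dfa A \<Gamma>) = proj \<Gamma> ` language A"
proof -
  let ?B = "proj_dfa A \<Gamma>"
  have B: "is_dfa ?B" using is_dfa_proj_dfa[OF assms] .
  have "(\<exists>S\<in>finals ?B. trans_word ?B (start ?B) v = Some S) \<longleftrightarrow>
        proj_reach A \<Gamma> {start A} v \<inter> finals A \<noteq> {}" if v: "v \<in> lists \<Gamma>" for v
  proof -
    have tw: "trans_word ?B (start ?B) v = Some (proj_reach A \<Gamma> {start A} v)"
      using trans_word_proj_dfa[of A \<Gamma> "start ?B" v]
      by (simp flip: proj_reach_append)
    have "proj_reach A \<Gamma> {start A} v \<in> states ?B"
      using trans_word_in_states[OF B _ _ tw] B v by (simp add: is_dfa_def)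
    then show ?thesis using tw by simp
  qed
  then have "language ?B = {v \<in> lists \<Gamma>. proj_reach A \<Gamma> {start A} v \<inter> finals A \<noteq> {}}"
    unfolding language_def proj_dfa_simps(2) by blast
  also have "\<dots> = proj \<Gamma> ` language A"
    by (auto simp: language_def proj_reach_def proj_def)
  finally show ?thesis .
qed

section \<open>Erased reachability as an equivalence relation\<close>

text \<open>The letter \<open>x\<close> permutes the closure \<open>?C\<close> of \<open>q\<close>,
  so \<open>q\<close> has a preimage in \<open>?C\<close>. Since \<open>x\<close> is injective on
  all states, this preimage is \<open>p\<close>.\<close>

lemma proj_reach_Nil_sym_letter:
  assumes "permutation_dfa A" "x \<in> alphabet A - \<Gamma>" "p \<in> states A" "trans A p x = Some q"
  shows "p \<in> proj_reach A \<Gamma> {q} []"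
proof -
  let ?C = "proj_reach A \<Gamma> {q} []" and ?f = "\<lambda>q. the (trans A q x)"
  have A: "is_dfa A" and fin: "finite (states A)" and inj: "inj_on ?f (states A)"
    using assms by (auto simp: permutation_dfa_def is_dfa_def bij_betw_def)
  have "q \<in> states A" using A assms by (auto simp: is_dfa_def)
  then have C: "?C \<subseteq> states A" using proj_reach_subset_states[OF A] by simp
  have "?f ` ?C \<subseteq> ?C"
  proof (rule image_subsetI)
    fix r assume r: "r \<in> ?C"
    then obtain s where s: "trans A r x = Some s"
      using permutation_dfa_trans_total[OF assms(1), of x r] assms(2) C by blast
    have "s \<in> proj_reach A \<Gamma> ?C (proj \<Gamma> [x])"
      using r s assms(2) by (intro proj_reachI) auto
    then show "?f r \<in> ?C"
      using s assms(2) by (simp add: proj_def flip: proj_reach_append)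
  qed
  then have "?f ` ?C = ?C"
    using C fin inj by (meson endo_inj_surj finite_subset inj_on_subset)
  moreover have "q \<in> ?C" using subset_proj_reach_Nil[of "{q}"] by blast
  ultimately have "q \<in> ?f ` ?C" by (simp only:)
  then obtain r where r: "r \<in> ?C" "?f r = q" by blast
  moreover have "?f p = q" using assms(4) by simp
  ultimately have "r = p" using inj C assms(3) by (metis inj_onD subsetD)
  then show ?thesis using r(1) by simp
qed

lemma proj_reach_Nil_trans:
  assumes "q \<in> proj_reach A \<Gamma> {p} []" "r \<in> proj_reach A \<Gamma> {q} []"
  shows "r \<in> proj_reach A \<Gamma> {p} []"
proof -
  have "r \<in> proj_reach A \<Gamma> (proj_reach A \<Gamma> {p} []) []"
    using assms by (subst proj_reach_UN) blast
  then show ?thesis by (simp flip: proj_reach_append)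
qed

text \<open>The run from \<open>p\<close> to \<open>q\<close> is undone one letter at a time.
  Undoing a single letter may take a longer path of erased letters; transitivity joins these
  paths.\<close>

lemma proj_reach_Nil_sym:
  assumes "permutation_dfa A" "p \<in> states A" "q \<in> proj_reach A \<Gamma> {p} []"
  shows "p \<in> proj_reach A \<Gamma> {q} []"
proof -
  have A: "is_dfa A" using assms by (simp add: permutation_dfa_def)
  \<comment> \<open>A word over the alphabet projects to the empty word exactly if all its letters
    are erased ones.\<close>
  obtain u where "u \<in> lists (alphabet A - \<Gamma>)" "trans_word A p u = Some q"
    using assms(3) by (auto simp: proj_reach_def proj_def filter_empty_conv)
  then show ?thesis
    using assms(2)
  proof (induction u arbitrary: p rule: list.induct)
    case Nil
    then show ?case using subset_proj_reach_Nil[of "{p}"] by auto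
  next
    case (Cons x u)
    then obtain r where r: "trans A p x = Some r" "trans_word A r u = Some q"
      by (auto simp: bind_eq_Some_conv)
    then have "r \<in> states A" using Cons.prems by (intro is_dfa_trans_in_states[OF A _ _ r(1)]) auto
    then have "r \<in> proj_reach A \<Gamma> {q} []" using Cons r by auto
    moreover have "p \<in> proj_reach A \<Gamma> {r} []"
      using proj_reach_Nil_sym_letter[OF assms(1)] Cons.prems r by auto
    ultimately show ?case by (rule proj_reach_Nil_trans)
  qed
qed

definition erased_equiv :: "('q, 'a) dfa \<Rightarrow> 'a set \<Rightarrow> ('q \<times> 'q) set" where
  "erased_equiv A \<Gamma> = {(p, q). p \<in> states A \<and> q \<in> proj_reach A \<Gamma> {p} []}"

lemma erased_equiv_Image:
  "p \<in> states A \<Longrightarrow> erased_equiv A \<Gamma> `` {p} = proj_reach A \<Gamma> {p} []"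
  by (auto simp: erased_equiv_def)

text \<open>Reflexivity comes from the empty word and transitivity from concatenation; symmetry is
  where the bijectivity of the letters enters.\<close>

lemma equiv_erased_equiv:
  assumes "permutation_dfa A"
  shows "equiv (states A) (erased_equiv A \<Gamma>)"
proof (rule equivI)
  have A: "is_dfa A" using assms by (simp add: permutation_dfa_def)
  show sub: "erased_equiv A \<Gamma> \<subseteq> states A \<times> states A"
    using proj_reach_subset_states[OF A, of "{_}"] by (auto simp: erased_equiv_def)
  show "refl_on (states A) (erased_equiv A \<Gamma>)"
    using subset_proj_reach_Nil[of "{_}"] by (auto simp: erased_equiv_def refl_on_def)
  show "sym (erased_equiv A \<Gamma>)"
  proof (rule symI)
    fix p q assume "(p, q) \<in> erased_equiv A \<Gamma>"
    moreover from this have "q \<in> states A" using sub by blast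
    ultimately show "(q, p) \<in> erased_equiv A \<Gamma>"
      using proj_reach_Nil_sym[OF assms] by (simp add: erased_equiv_def)
  qed
  show "Relation.trans (erased_equiv A \<Gamma>)"
    using proj_reach_Nil_trans by (fastforce simp: erased_equiv_def Relation.trans_def)
qed

section \<open>Counting classes and closed sets\<close>

text \<open>The classes partition \<open>Q\<close>, so an inequality for each single class can be
  summed. Doubling keeps the count free of halves and rounding.\<close>

lemma card_quotient_le_of_nontrivial_classes:
  assumes "equiv Q E" "finite Q" "N \<subseteq> Q"
    and nontriv: "\<And>p. p \<in> N \<Longrightarrow> \<exists>q. q \<noteq> p \<and> (p, q) \<in> E"
  shows "2 * card (Q // E) + card N \<le> 2 * card Q"
proof -
  have fin: "finite (Q // E)"
    using assms by (simp add: equiv_type finite_quotient)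
  have finC: "finite C" if "C \<in> Q // E" for C
    using that assms by (meson finite_equiv_class equiv_type)
  have disj: "C \<inter> D = {}" if "C \<in> Q // E" "D \<in> Q // E" "C \<noteq> D" for C D
    using quotient_disj[OF assms(1)] that by blast
  \<comment> \<open>A class that misses \<open>N\<close> has at least one element, which pays for
    the 2. A class that meets \<open>N\<close> has at least two: one copy of \<open>card C\<close>
    pays for the 2, the other for \<open>card (C \<inter> N)\<close>.\<close>
  have le: "2 + card (C \<inter> N) \<le> 2 * card C" if C: "C \<in> Q // E" for C
  proof (cases "C \<inter> N = {}")
    case True
    have "C \<noteq> {}" using C assms(1) by (simp add: in_quotient_imp_non_empty)
    then have "card C \<noteq> 0" using finC[OF C] by simp
    then show ?thesis using True by simp
  next
    case False
    then obtain p where p: "p \<in> C" "p \<in> N" by blast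
    then obtain q where q: "q \<noteq> p" "(p, q) \<in> E" using nontriv by blast
    then have "q \<in> C" using p C assms(1) by (meson in_quotient_imp_closed)
    then have "card {p, q} \<le> card C" using p finC[OF C] by (intro card_mono) auto
    moreover have "card (C \<inter> N) \<le> card C" using finC[OF C] by (intro card_mono) auto
    ultimately show ?thesis using q by simp
  qed
  have "card Q = card (\<Union>C\<in>Q // E. C)" using assms(1) by (simp add: Union_quotient)
  also have "\<dots> = (\<Sum>C\<in>Q // E. card C)"
    using fin finC disj by (intro card_UN_disjoint) auto
  finally have Q: "card Q = (\<Sum>C\<in>Q // E. card C)" .
  have "N = (\<Union>C\<in>Q // E. C \<inter> N)" using Union_quotient[OF assms(1)] assms(3) by blast
  then have "card N = card (\<Union>C\<in>Q // E. C \<inter> N)" by simp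
  also have "\<dots> = (\<Sum>C\<in>Q // E. card (C \<inter> N))"
    using fin finC disj by (intro card_UN_disjoint) blast+
  finally have "2 * card (Q // E) + card N = (\<Sum>C\<in>Q // E. 2 + card (C \<inter> N))"
    by (simp add: sum.distrib del: add_2_eq_Suc)
  also have "\<dots> \<le> (\<Sum>C\<in>Q // E. 2 * card C)" using le by (rule sum_mono)
  finally show ?thesis using Q by (simp add: sum_distrib_left)
qed

lemma card_erased_classes:
  assumes "permutation_dfa A"
  shows "2 * card (states A // erased_equiv A \<Gamma>) + card (nonloop_states A (alphabet A - \<Gamma>))
    \<le> 2 * card (states A)"
proof (rule card_quotient_le_of_nontrivial_classes)
  show eq: "equiv (states A) (erased_equiv A \<Gamma>)" using equiv_erased_equiv[OF assms] .
  show "finite (states A)" using assms by (simp add: permutation_dfa_def is_dfa_def)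
  show "nonloop_states A (alphabet A - \<Gamma>) \<subseteq> states A" by (auto simp: nonloop_states_def)
  fix s assume "s \<in> nonloop_states A (alphabet A - \<Gamma>)"
  then obtain p q x where pq: "p \<in> states A" "x \<in> alphabet A - \<Gamma>" "p \<noteq> q" "s \<in> {p, q}"
    "trans A p x = Some q"
    by (auto simp: nonloop_states_def)
  have "q \<in> proj_reach A \<Gamma> {p} (proj \<Gamma> [x])" using pq by (intro proj_reachI) auto
  then have "(p, q) \<in> erased_equiv A \<Gamma>" using pq by (simp add: erased_equiv_def proj_def)
  \<comment> \<open>The state \<open>s\<close> may also be the target of the transition; its partner
    is then the source, by symmetry.\<close>
  moreover from this have "(q, p) \<in> erased_equiv A \<Gamma>" using eq by (meson equivE symD)
  ultimately show "\<exists>r. r \<noteq> s \<and> (s, r) \<in> erased_equiv A \<Gamma>" using pq by auto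
qed

text \<open>A closed set is the union of the closures of its points, which are classes. It is thus
  the union of a set of classes, nonempty because the closed set is; the excluded empty set of
  classes accounts for the \<open>- 1\<close>.\<close>

lemma card_states_proj_dfa:
  assumes "permutation_dfa A"
  shows "card (states (proj_dfa A \<Gamma>)) \<le> 2 ^ card (states A // erased_equiv A \<Gamma>) - 1"
proof -
  let ?K = "states A // erased_equiv A \<Gamma>"
  have "finite (states A)" using assms by (simp add: permutation_dfa_def is_dfa_def)
  then have fin: "finite ?K"
    using equiv_erased_equiv[OF assms] by (simp add: equiv_type finite_quotient)
  have "states (proj_dfa A \<Gamma>) \<subseteq> Union ` (Pow ?K - {{}})"
  proof
    fix S assume "S \<in> states (proj_dfa A \<Gamma>)"
    then have S: "S \<subseteq> states A" "S \<noteq> {}" "proj_reach A \<Gamma> S [] = S" by simp_all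
    let ?c = "(\<lambda>p. erased_equiv A \<Gamma> `` {p}) ` S"
    have "\<Union> ?c = S"
    proof -
      have "\<Union> ?c = (\<Union>p\<in>S. proj_reach A \<Gamma> {p} [])"
        using S(1) by (intro SUP_cong refl erased_equiv_Image) blast
      also have "\<dots> = S" using S(3) by (simp flip: proj_reach_UN)
      finally show ?thesis .
    qed
    moreover have "?c \<in> Pow ?K - {{}}" using S by (auto simp: quotient_def)
    ultimately show "S \<in> Union ` (Pow ?K - {{}})" by (metis imageI)
  qed
  then have "card (states (proj_dfa A \<Gamma>)) \<le> card (Pow ?K - {{}})"
    using fin by (intro surj_card_le) auto
  also have "\<dots> = 2 ^ card ?K - 1" using fin by (simp add: card_Pow)
  finally show ?thesis .
qed

section \<open>The case where all erased transitions are loops\<close>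

text \<open>An erased letter leaves the state where it is, so dropping it does not affect the rest
  of the run.\<close>

lemma trans_word_proj_of_loops:
  assumes "is_dfa A" "\<And>p x. p \<in> states A \<Longrightarrow> x \<in> alphabet A - \<Gamma> \<Longrightarrow> trans A p x = Some p"
    and "q \<in> states A" "u \<in> lists (alphabet A)"
  shows "trans_word A q (proj \<Gamma> u) = trans_word A q u"
  using assms(3,4)
proof (induction u arbitrary: q)
  case (Cons x u)
  show ?case
  proof (cases "x \<in> \<Gamma>")
    case True
    with Cons assms(1) show ?thesis
      by (cases "trans A q x") (auto simp: proj_def is_dfa_def)
  next
    case False
    with Cons assms(2) show ?thesis by (simp add: proj_def)
  qed
qed (simp add: proj_def)

text \<open>The same states and transitions serve over the smaller alphabet: a word over
  \<open>\<Gamma>\<close> is its own projection, and a word and its projection lead to the same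
  state.\<close>

lemma recognizable_proj_of_loops:
  assumes A: "is_dfa A" and \<Gamma>: "\<Gamma> \<subseteq> alphabet A"
    and loops: "\<And>p x. p \<in> states A \<Longrightarrow> x \<in> alphabet A - \<Gamma> \<Longrightarrow> trans A p x = Some p"
  shows "recognizable \<Gamma> (card (states A)) (proj \<Gamma> ` language A)"
proof -
  let ?B = "A\<lparr>alphabet := \<Gamma>\<rparr>"
  have tw: "trans_word ?B q v = trans_word A q v" for q v
    by (induction v arbitrary: q) simp_all
  have "is_dfa ?B" using A \<Gamma> by (auto simp: is_dfa_def intro: finite_subset)
  moreover have "language ?B = proj \<Gamma> ` language A"
  proof (intro equalityI subsetI)
    fix v assume v: "v \<in> language ?B"
    then have "proj \<Gamma> v = v" by (auto simp: language_def proj_def filter_id_conv)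
    moreover have "v \<in> language A" using v \<Gamma> by (auto simp: language_def tw)
    ultimately show "v \<in> proj \<Gamma> ` language A" by (metis imageI)
  next
    fix v assume "v \<in> proj \<Gamma> ` language A"
    then obtain u where "u \<in> language A" "v = proj \<Gamma> u" by blast
    moreover have "proj \<Gamma> u \<in> lists \<Gamma>" by (auto simp: proj_def)
    moreover have "start A \<in> states A" using A by (simp add: is_dfa_def)
    ultimately show "v \<in> language ?B"
      using trans_word_proj_of_loops[OF A loops] by (auto simp: language_def tw)
  qed
  ultimately show ?thesis using recognizableI[of ?B "card (states A)"] by simp
qed

theorem theorem5:
  fixes A :: "('q, 'a) dfa" and \<Gamma> :: "'a set" and m :: nat
  assumes "permutation_dfa A"
    and "\<Gamma> \<subseteq> alphabet A"
    and "m = card (nonloop_states A (alphabet A - \<Gamma>))"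
  shows "(m > 0 \<longrightarrow>
           recognizable \<Gamma> (2 ^ (card (states A) - nat \<lceil>real m / 2\<rceil>) - 1)
             (proj \<Gamma> ` language A)) \<and>
         (m = 0 \<longrightarrow> recognizable \<Gamma> (card (states A)) (proj \<Gamma> ` language A))"
proof (intro conjI impI)
  let ?k = "card (states A // erased_equiv A \<Gamma>)"
  have "2 * ?k + m \<le> 2 * card (states A)" using card_erased_classes[OF assms(1)] assms(3) by simp
  \<comment> \<open>The difference is taken between integers, so the bound on
    \<open>real m / 2\<close> survives rounding up. Since the ceiling is nonnegative, passing to
    \<open>nat\<close> then loses nothing.\<close>
  then have "real m / 2 \<le> real_of_int (int (card (states A)) - int ?k)" by simp
  then have "\<lceil>real m / 2\<rceil> \<le> int (card (states A)) - int ?k" by (rule ceiling_le)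
  moreover have "0 \<le> \<lceil>real m / 2\<rceil>" by simp
  ultimately have "?k \<le> card (states A) - nat \<lceil>real m / 2\<rceil>" by linarith
  then have "(2::nat) ^ ?k - 1 \<le> 2 ^ (card (states A) - nat \<lceil>real m / 2\<rceil>) - 1"
    by (intro diff_le_mono power_increasing) simp_all
  then have "card (states (proj_dfa A \<Gamma>)) \<le> 2 ^ (card (states A) - nat \<lceil>real m / 2\<rceil>) - 1"
    using card_states_proj_dfa[OF assms(1), of \<Gamma>] by linarith
  then show "recognizable \<Gamma> (2 ^ (card (states A) - nat \<lceil>real m / 2\<rceil>) - 1)
      (proj \<Gamma> ` language A)"
    using recognizableI[OF is_dfa_proj_dfa[OF assms(1,2)]] language_proj_dfa[OF assms(1,2)]
    by simp
next
  assume "m = 0"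
  have A: "is_dfa A" using assms by (simp add: permutation_dfa_def)
  \<comment> \<open>An infinite set would also have \<open>card\<close> equal to 0; finiteness is
    what turns \<open>m = 0\<close> into emptiness.\<close>
  then have "finite (nonloop_states A (alphabet A - \<Gamma>))"
    by (auto simp: is_dfa_def nonloop_states_def)
  then have N: "nonloop_states A (alphabet A - \<Gamma>) = {}" using \<open>m = 0\<close> assms(3) by simp
  \<comment> \<open>The absence of non-loops alone would still allow undefined transitions. Totality
    supplies a target, and the target can only be \<open>p\<close>.\<close>
  have "trans A p x = Some p" if p: "p \<in> states A" and x: "x \<in> alphabet A - \<Gamma>" for p x
  proof -
    obtain q where "q \<in> states A" "trans A p x = Some q"
      using permutation_dfa_trans_total[OF assms(1), of x p] p x by blast
    moreover from this have "p \<in> nonloop_states A (alphabet A - \<Gamma>)" if "p \<noteq> q"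
      unfolding nonloop_states_def using that p x by blast
    ultimately show ?thesis using N by auto
  qed
  then show "recognizable \<Gamma> (card (states A)) (proj \<Gamma> ` language A)"
    using recognizable_proj_of_loops[OF A assms(2)] by blast
qed

end
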